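(* Let $T$ be an ergodic $\mathbb{Z}^d$-action and let $L\in\mathbb{G}_{e,d}$, $0<e<d$, be a completely rational direction. Let $\Lambda=\mathbb{Z}^d\cap L$. Then the restriction $T^{|\Lambda}=\{T^{\vec n}\}_{\vec n\in\Lambda}$ is an ergodic $\Lambda$-action if and only if $T$ is ergodic in the direction $L$; and $T^{|\Lambda}$ is a weak mixing $\Lambda$-action if and only if $T$ is weak mixing in the direction $L$.
   Context: All actions are free measurable measure preserving actions on a Lebesgue probability space $(X,\mu)$. $\mathbb{G}_{e,d}$ is the set of $e$-dimensional linear subspaces of $\mathbb{R}^d$. $L\in\mathbb{G}_{e,d}$ is completely rational if $L\cap\mathbb{Z}^d$ is isomorphic to $\mathbb{Z}^e$. An action of an abelian group is ergodic if the only invariant $L^2$ functions are constants, and weak mixing if the only $L^2$ eigenfunctions are constants. Unit suspension. $\widetilde T$ is the $\mathbb{R}^d$-action on $(\widetilde X,\tilde\mu)=(X\times[0,1)^d,\mu\times\lambda)$, $\lambda$ Lebesgue measure, given by $\widetilde T^{\vec t}(x,\vec r)=(T^{\lfloor\vec t+\vec r\rfloor}x,\{\vec t+\vec r\})$, with componentwise integer part $\lfloor\cdot\rfloor$ and fractional part $\{\cdot\}$. Let $\mathcal{O}=\{F(x,\vec s)=f(\vec s): f\in L^2([0,1)^d,\lambda)\}\subseteq L^2(\widetilde X,\tilde\mu)$ and $L^2_{\mathcal{O}}(\widetilde X,\tilde\mu)=\mathcal{O}^\perp$. Directional properties of a $\mathbb{Z}^d$-action. Let $L\in\mathbb{G}_{e,d}$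 with $1\le e\le d$. A nonzero $F\in L^2(\widetilde X,\tilde\mu)$ is a direction $L$ eigenfunction of $\widetilde T$ if for some $\vec\ell\in L$ one has $F(\widetilde T^{\vec t}y)=e^{2\pi i\vec\ell\cdot\vec t}F(y)$ for all $\vec t\in L$ and a.e. $y$; it is direction $L$ invariant if this holds with $\vec\ell=\vec 0$. $T$ is ergodic in the direction $L$ if $\widetilde T$ has no nonzero direction $L$ invariant function in $L^2_{\mathcal{O}}(\widetilde X,\tilde\mu)$; $T$ is weak mixing in the direction $L$ if $\widetilde T$ has no nonzero direction $L$ eigenfunction in $L^2_{\mathcal{O}}(\widetilde X,\tilde\mu)$. *)

theory Defs
  imports "HOL-Probability.Probability" "HOL-Algebra.Product_Groups"
begin

text \<open>Two measure spaces are isomorphic mod 0 if, after discarding a null set from each, there is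
  a bimeasurable measure preserving bijection between what remains.\<close>

definition isomorphic_mod0 :: "'a measure \<Rightarrow> 'b measure \<Rightarrow> bool" where
  "isomorphic_mod0 M N \<longleftrightarrow>
     (\<exists>A\<in>sets M. \<exists>B\<in>sets N. \<exists>\<phi> \<psi>.
        space M - A \<in> null_sets M \<and> space N - B \<in> null_sets N \<and>
        \<phi> \<in> measurable (restrict_space M A) (restrict_space N B) \<and>
        \<psi> \<in> measurable (restrict_space N B) (restrict_space M A) \<and>
        (\<forall>x\<in>A. \<psi> (\<phi> x) = x) \<and> (\<forall>y\<in>B. \<phi> (\<psi> y) = y) \<and>
        distr (restrict_space M A) (restrict_space N B) \<phi> = restrict_space N B)"

text \<open>A Lebesgue probability space. The condition is put on the completion, so that both a
  standard Borel probability space and its completion qualify. Atoms need not be allowed for: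
  a free measure preserving action of an infinite group on a probability space excludes them.\<close>

definition lebesgue_prob_space :: "'a measure \<Rightarrow> bool" where
  "lebesgue_prob_space M \<longleftrightarrow>
     prob_space M \<and> isomorphic_mod0 (completion M) (lebesgue_on {0..1::real})"

text \<open>Actions are indexed by a subset \<open>G\<close> of an ambient abelian group, so that the restriction of
  an action \<open>T\<close> to a subgroup \<open>G\<close> is \<open>T\<close> itself considered on \<open>G\<close>.\<close>

definition free_mp_action :: "'a measure \<Rightarrow> 'g::ab_group_add set \<Rightarrow> ('g \<Rightarrow> 'a \<Rightarrow> 'a) \<Rightarrow> bool" where
  "free_mp_action M G T \<longleftrightarrow>
     (\<forall>g\<in>G. T g \<in> measurable M M \<and> distr M M (T g) = M) \<and>
     (\<forall>x\<in>space M. T 0 x = x) \<and>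
     (\<forall>g\<in>G. \<forall>h\<in>G. \<forall>x\<in>space M. T (g + h) x = T g (T h x)) \<and>
     (AE x in M. \<forall>g\<in>G. g \<noteq> 0 \<longrightarrow> T g x \<noteq> x)"

text \<open>Elements of \<open>L\<^sup>2\<close> are represented by functions; equality in \<open>L\<^sup>2\<close> is equality almost
  everywhere, and is written out as such.\<close>

definition L2 :: "'a measure \<Rightarrow> ('a \<Rightarrow> complex) set" where
  "L2 M = {f \<in> borel_measurable M. integrable M (\<lambda>x. (norm (f x))\<^sup>2)}"

definition L2_inner :: "'a measure \<Rightarrow> ('a \<Rightarrow> complex) \<Rightarrow> ('a \<Rightarrow> complex) \<Rightarrow> complex" where
  "L2_inner M f g = (LINT x|M. f x * cnj (g x))"

definition L2_nonzero :: "'a measure \<Rightarrow> ('a \<Rightarrow> complex) \<Rightarrow> bool" where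
  "L2_nonzero M f \<longleftrightarrow> \<not> (AE x in M. f x = 0)"

definition L2_constant :: "'a measure \<Rightarrow> ('a \<Rightarrow> complex) \<Rightarrow> bool" where
  "L2_constant M f \<longleftrightarrow> (\<exists>c. AE x in M. f x = c)"

definition character_on :: "'g::ab_group_add set \<Rightarrow> ('g \<Rightarrow> complex) \<Rightarrow> bool" where
  "character_on G \<kappa> \<longleftrightarrow>
     (\<forall>g\<in>G. norm (\<kappa> g) = 1) \<and> (\<forall>g\<in>G. \<forall>h\<in>G. \<kappa> (g + h) = \<kappa> g * \<kappa> h)"

definition invariant_function ::
    "'a measure \<Rightarrow> 'g::ab_group_add set \<Rightarrow> ('g \<Rightarrow> 'a \<Rightarrow> 'a) \<Rightarrow> ('a \<Rightarrow> complex) \<Rightarrow> bool" where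
  "invariant_function M G T f \<longleftrightarrow> (\<forall>g\<in>G. AE x in M. f (T g x) = f x)"

definition eigenfunction ::
    "'a measure \<Rightarrow> 'g::ab_group_add set \<Rightarrow> ('g \<Rightarrow> 'a \<Rightarrow> 'a) \<Rightarrow> ('a \<Rightarrow> complex) \<Rightarrow> bool" where
  "eigenfunction M G T f \<longleftrightarrow>
     L2_nonzero M f \<and>
     (\<exists>\<kappa>. character_on G \<kappa> \<and> (\<forall>g\<in>G. AE x in M. f (T g x) = \<kappa> g * f x))"

definition ergodic_action :: "'a measure \<Rightarrow> 'g::ab_group_add set \<Rightarrow> ('g \<Rightarrow> 'a \<Rightarrow> 'a) \<Rightarrow> bool" where
  "ergodic_action M G T \<longleftrightarrow> (\<forall>f\<in>L2 M. invariant_function M G T f \<longrightarrow> L2_constant M f)"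

definition weak_mixing_action :: "'a measure \<Rightarrow> 'g::ab_group_add set \<Rightarrow> ('g \<Rightarrow> 'a \<Rightarrow> 'a) \<Rightarrow> bool" where
  "weak_mixing_action M G T \<longleftrightarrow> (\<forall>f\<in>L2 M. eigenfunction M G T f \<longrightarrow> L2_constant M f)"

definition grassmannian :: "nat \<Rightarrow> (real^'d) set set" where
  "grassmannian e = {L. subspace L \<and> dim L = e}"

definition vec_of_int :: "int^'d \<Rightarrow> real^'d" where
  "vec_of_int n = (\<chi> i. of_int (n $ i))"

text \<open>\<open>\<int>\<^sup>d \<inter> L\<close>, as a set of integer vectors.\<close>

definition lattice_of :: "(real^'d) set \<Rightarrow> (int^'d) set" where
  "lattice_of L = {n. vec_of_int n \<in> L}"

definition lattice_group :: "(real^'d) set \<Rightarrow> (int^'d) monoid" where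
  "lattice_group L = \<lparr>carrier = lattice_of L, monoid.mult = (+), one = 0\<rparr>"

definition completely_rational :: "(real^'d) set \<Rightarrow> bool" where
  "completely_rational L \<longleftrightarrow>
     lattice_group L \<cong> product_group {..<dim L} (\<lambda>_. integer_group)"

definition vfloor :: "real^'d \<Rightarrow> int^'d" where
  "vfloor v = (\<chi> i. \<lfloor>v $ i\<rfloor>)"

definition vfrac :: "real^'d \<Rightarrow> real^'d" where
  "vfrac v = (\<chi> i. frac (v $ i))"

definition unit_cube :: "(real^'d) set" where
  "unit_cube = {r. \<forall>i. 0 \<le> r $ i \<and> r $ i < 1}"

text \<open>The product measure is not completed; this does not affect \<open>L\<^sup>2\<close>, as its elements are only
  considered up to null sets.\<close>

definition suspension_space :: "'a measure \<Rightarrow> ('a \<times> (real^'d)) measure" where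
  "suspension_space M = M \<Otimes>\<^sub>M lebesgue_on unit_cube"

definition suspension :: "(int^'d \<Rightarrow> 'a \<Rightarrow> 'a) \<Rightarrow> real^'d \<Rightarrow> 'a \<times> (real^'d) \<Rightarrow> 'a \<times> (real^'d)" where
  "suspension T t = (\<lambda>(x, r). (T (vfloor (t + r)) x, vfrac (t + r)))"

definition cube_functions :: "('a \<times> (real^'d) \<Rightarrow> complex) set" where
  "cube_functions = {(\<lambda>(x, s). f s) | f. f \<in> L2 (lebesgue_on unit_cube)}"

definition L2_orth_cube :: "'a measure \<Rightarrow> ('a \<times> (real^'d) \<Rightarrow> complex) set" where
  "L2_orth_cube M =
     {F \<in> L2 (suspension_space M). \<forall>H\<in>cube_functions. L2_inner (suspension_space M) F H = 0}"

text \<open>The exceptional null set may depend on \<open>t\<close>: the eigenvalue equation is an identity in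
  \<open>L\<^sup>2\<close> for each \<open>t\<close>.\<close>

definition eigen_equation ::
    "'a measure \<Rightarrow> (int^'d \<Rightarrow> 'a \<Rightarrow> 'a) \<Rightarrow> (real^'d) set \<Rightarrow> real^'d \<Rightarrow>
     ('a \<times> (real^'d) \<Rightarrow> complex) \<Rightarrow> bool" where
  "eigen_equation M T L l F \<longleftrightarrow>
     (\<forall>t\<in>L. AE y in suspension_space M.
        F (suspension T t y) = exp (2 * of_real pi * \<i> * of_real (l \<bullet> t)) * F y)"

definition direction_eigenfunction ::
    "'a measure \<Rightarrow> (int^'d \<Rightarrow> 'a \<Rightarrow> 'a) \<Rightarrow> (real^'d) set \<Rightarrow> ('a \<times> (real^'d) \<Rightarrow> complex) \<Rightarrow> bool" where
  "direction_eigenfunction M T L F \<longleftrightarrow>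
     L2_nonzero (suspension_space M) F \<and> (\<exists>l\<in>L. eigen_equation M T L l F)"

definition direction_invariant ::
    "'a measure \<Rightarrow> (int^'d \<Rightarrow> 'a \<Rightarrow> 'a) \<Rightarrow> (real^'d) set \<Rightarrow> ('a \<times> (real^'d) \<Rightarrow> complex) \<Rightarrow> bool" where
  "direction_invariant M T L F \<longleftrightarrow>
     L2_nonzero (suspension_space M) F \<and> eigen_equation M T L 0 F"

definition ergodic_in_direction ::
    "'a measure \<Rightarrow> (int^'d \<Rightarrow> 'a \<Rightarrow> 'a) \<Rightarrow> (real^'d) set \<Rightarrow> bool" where
  "ergodic_in_direction M T L \<longleftrightarrow> \<not> (\<exists>F\<in>L2_orth_cube M. direction_invariant M T L F)"

definition weak_mixing_in_direction ::
    "'a measure \<Rightarrow> (int^'d \<Rightarrow> 'a \<Rightarrow> 'a) \<Rightarrow> (real^'d) set \<Rightarrow> bool" where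
  "weak_mixing_in_direction M T L \<longleftrightarrow> \<not> (\<exists>F\<in>L2_orth_cube M. direction_eigenfunction M T L F)"

end

theory Submission
  imports Defs
begin

text \<open>Write \<open>\<Lambda> = \<int>\<^sup>d \<inter> L\<close> and, for \<open>l\<close> in \<open>L\<close>, let \<open>e\<^sub>l(v)\<close> be the character
  \<open>exp (2 \<pi> i l \<bullet> v)\<close>. Both equivalences are cases of one correspondence, for each single frequency
  \<open>l\<close>: the suspension has a nonzero direction \<open>L\<close> eigenfunction of frequency \<open>l\<close> orthogonal to the
  functions of the cube coordinate if and only if the restriction of \<open>T\<close> to \<open>\<Lambda>\<close> has a nonzero
  eigenfunction of mean zero whose eigenvalue is the restriction of \<open>e\<^sub>l\<close> to \<open>\<Lambda>\<close>
  (\<open>direction_eigenfunction_iff\<close>). Mean zero is the counterpart of orthogonality, since a function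
  is orthogonal to all functions of the cube coordinate exactly when almost all of its slices
  \<open>F(\<cdot>, r)\<close> have integral zero.

  From the suspension to \<open>X\<close> (\<open>slice_eigenfunction\<close>): for \<open>n\<close> in \<open>\<Lambda>\<close> the suspension flow at time \<open>n\<close>
  is \<open>T\<^sup>n\<close> on every fibre \<open>r = const\<close>, so almost every slice of \<open>F\<close> satisfies the eigenvalue
  equation and has mean zero, while the nonzero slices occupy a set of positive measure.

  From \<open>X\<close> to the suspension (\<open>induced_eigenfunction\<close>): think of the suspension as
  \<open>X \<times> \<real>\<^sup>d\<close> modulo \<open>(x, r) \<sim> (T\<^sup>m x, r - m)\<close>. On a tube \<open>U\<close> around \<open>L\<close> put
  \<open>F(x, r) = e\<^sub>l(r) f(x)\<close>, spread this to the integer translates of \<open>U\<close> by the identification, and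
  put \<open>0\<close> elsewhere. A translation of \<open>r\<close> along \<open>L\<close> then only changes \<open>F\<close> by \<open>e\<^sub>l\<close>. There is
  no conflict between translates provided that two of them meet only if they differ by an element
  of \<open>\<Lambda>\<close>, for which the two prescriptions agree because \<open>f\<close> is an eigenfunction. A thin tube has
  this property because integer vectors outside \<open>L\<close> stay away from \<open>L\<close>
  (\<open>completely_rational_gap\<close>).

  Ergodicity is the case \<open>l = 0\<close>. For weak mixing one needs in addition that every character of
  \<open>\<Lambda>\<close> is the restriction of some \<open>e\<^sub>l\<close> with \<open>l\<close> in \<open>L\<close> (\<open>character_on_lattice\<close>). The gap and the
  extension of characters rest on complete rationality through \<open>completely_rational_basis\<close>:
  a \<open>\<int>\<close>-basis of \<open>\<Lambda>\<close> is an \<open>\<real>\<close>-basis of \<open>L\<close>.\<close>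

section \<open>Integer vectors in a subspace\<close>

lemma vec_of_int_nth [simp]: "vec_of_int n $ i = of_int (n $ i)"
  by (simp add: vec_of_int_def)

lemma vec_of_int_0 [simp]: "vec_of_int 0 = 0"
  by (simp add: vec_eq_iff)

lemma vec_of_int_add: "vec_of_int (m + n) = vec_of_int m + vec_of_int n"
  by (simp add: vec_eq_iff)

lemma vec_of_int_diff: "vec_of_int (m - n) = vec_of_int m - vec_of_int n"
  by (simp add: vec_eq_iff)

lemma vec_of_int_inject: "vec_of_int m = vec_of_int n \<longleftrightarrow> m = n"
  by (simp add: vec_eq_iff)

definition plane_wave :: "real^'d \<Rightarrow> real^'d \<Rightarrow> complex" where
  "plane_wave l v = exp (2 * of_real pi * \<i> * of_real (l \<bullet> v))"

lemma plane_wave_add: "plane_wave l (v + w) = plane_wave l v * plane_wave l w"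
  by (simp add: plane_wave_def inner_add_right exp_add[symmetric] distrib_left)

lemma norm_plane_wave [simp]: "norm (plane_wave l v) = 1"
  using norm_exp_i_times[of "2 * pi * (l \<bullet> v)"] by (simp add: plane_wave_def mult_ac)

lemma plane_wave_nonzero [simp]: "plane_wave l v \<noteq> 0"
  by (simp add: plane_wave_def)

lemma plane_wave_0 [simp]: "plane_wave l 0 = 1" "plane_wave 0 v = 1"
  by (simp_all add: plane_wave_def)

lemma lattice_of_diff:
  assumes "subspace L" "m \<in> lattice_of L" "n \<in> lattice_of L"
  shows "m - n \<in> lattice_of L"
  using assms by (simp add: lattice_of_def vec_of_int_diff subspace_diff)

lemma group_lattice_group:
  assumes "subspace L"
  shows "group (lattice_group L)"
proof (rule groupI)
  fix x assume "x \<in> carrier (lattice_group L)"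
  then have "0 - x \<in> lattice_of L"
    using lattice_of_diff[OF assms, of 0 x] subspace_0[OF assms] by (simp add: lattice_group_def lattice_of_def)
  then show "\<exists>y\<in>carrier (lattice_group L). y \<otimes>\<^bsub>lattice_group L\<^esub> x = \<one>\<^bsub>lattice_group L\<^esub>"
    by (intro bexI[of _ "0 - x"]) (simp_all add: lattice_group_def)
qed (use assms in \<open>auto simp: lattice_group_def lattice_of_def vec_of_int_add subspace_add subspace_0\<close>)

text \<open>On finitely supported integer sequences an additive map is determined by its values on the unit
  sequences; this recovers coordinates from an abstract group isomorphism.\<close>

lemma additive_int_combination:
  fixes A :: "(nat \<Rightarrow> int) \<Rightarrow> 'v::real_vector"
  assumes add: "\<And>n m. A (\<lambda>i. n i + m i) = A n + A m"
  shows "A (\<lambda>i. if i < k then n i else 0) = (\<Sum>j<k. of_int (n j) *\<^sub>R A (\<lambda>i. of_bool (i = j)))"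
proof -
  have zero: "A (\<lambda>i. 0) = 0"
    using add[of "\<lambda>i. 0" "\<lambda>i. 0"] by simp
  have single: "A (\<lambda>i. if i = j then c else 0) = of_int c *\<^sub>R A (\<lambda>i. of_bool (i = j))" for j c
  proof (induction c rule: int_induct[where k = 0])
    case base
    then show ?case by (simp add: zero)
  next
    case (step1 c)
    have "(\<lambda>i. if i = j then c + 1 else 0) = (\<lambda>i. (if i = j then c else 0) + of_bool (i = j))"
      by auto
    then show ?case by (simp add: add step1 scaleR_add_left)
  next
    case (step2 c)
    have "(\<lambda>i. if i = j then c else 0) = (\<lambda>i. (if i = j then c - 1 else 0) + of_bool (i = j))"
      by auto
    then have "A (\<lambda>i. if i = j then c else 0)
        = A (\<lambda>i. if i = j then c - 1 else 0) + A (\<lambda>i. of_bool (i = j))"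
      by (simp only: add)
    then have "of_int c *\<^sub>R A (\<lambda>i. of_bool (i = j))
        = A (\<lambda>i. if i = j then c - 1 else 0) + A (\<lambda>i. of_bool (i = j))"
      by (simp only: step2)
    then show ?case by (simp add: scaleR_diff_left)
  qed
  show ?thesis
  proof (induction k)
    case (Suc k)
    have "(\<lambda>i. if i < Suc k then n i else 0)
        = (\<lambda>i. (if i < k then n i else 0) + (if i = k then n k else 0))"
      by (auto simp: less_Suc_eq)
    then show ?case by (simp add: add Suc single)
  qed (simp add: zero)
qed

section \<open>A lattice basis is a basis of the subspace\<close>

text \<open>The images of the unit sequences under the inverse of the given isomorphism. Injectivity of the
  isomorphism becomes independence over \<open>\<int>\<close>, surjectivity becomes generation.\<close>

lemma completely_rational_coordinates:
  fixes L :: "(real^'d) set"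
  assumes L: "subspace L" and rational: "completely_rational L"
  obtains b :: "nat \<Rightarrow> int^'d"
  where "\<And>j. j < dim L \<Longrightarrow> b j \<in> lattice_of L"
    and "\<And>v. v \<in> lattice_of L \<Longrightarrow>
           \<exists>n. vec_of_int v = (\<Sum>j<dim L. of_int (n j) *\<^sub>R vec_of_int (b j))"
    and "\<And>n j. (\<Sum>j<dim L. of_int (n j) *\<^sub>R (vec_of_int (b j) :: real^'d)) = 0 \<Longrightarrow> j < dim L \<Longrightarrow> n j = 0"
proof -
  let ?e = "dim L"
  let ?P = "product_group {..<?e} (\<lambda>_. integer_group)"
  obtain h where h: "h \<in> iso (lattice_group L) ?P"
    using rational by (auto simp: completely_rational_def is_iso_def)
  obtain g where g: "g \<in> iso ?P (lattice_group L)"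
    using group.iso_set_sym[OF group_lattice_group[OF L] h] by blast
  have g_mult: "g (\<lambda>i\<in>{..<?e}. x i + y i) = g x + g y"
    if "x \<in> extensional {..<?e}" "y \<in> extensional {..<?e}" for x y
    using g that by (auto simp: iso_iff hom_def lattice_group_def PiE_def)
  have g_bij: "bij_betw g (extensional {..<?e}) (lattice_of L)"
    using g by (auto simp: iso_def lattice_group_def PiE_def)
  define A :: "(nat \<Rightarrow> int) \<Rightarrow> int^'d" where "A n = g (restrict n {..<?e})" for n
  define b where "b j = A (\<lambda>i. of_bool (i = j))" for j
  have A_add: "A (\<lambda>i. n i + m i) = A n + A m" for n m
  proof -
    have "restrict (\<lambda>i. n i + m i) {..<?e}
        = (\<lambda>i\<in>{..<?e}. restrict n {..<?e} i + restrict m {..<?e} i)"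
      by auto
    then show ?thesis
      unfolding A_def by (metis g_mult restrict_extensional)
  qed
  have A_cong: "A n = A (\<lambda>i. if i < ?e then n i else 0)" for n
    unfolding A_def by (rule arg_cong[of _ _ g]) auto
  have A_eq: "vec_of_int (A n) = (\<Sum>j<?e. of_int (n j) *\<^sub>R (vec_of_int (b j) :: real^'d))" for n
    unfolding b_def
    by (subst A_cong, subst additive_int_combination) (simp_all add: A_add vec_of_int_add)
  have A_in: "A n \<in> lattice_of L" for n
    unfolding A_def using g_bij by (auto simp: bij_betw_def)
  show thesis
  proof
    show "b j \<in> lattice_of L" for j
      by (simp add: b_def A_in)
    show "\<exists>n. vec_of_int v = (\<Sum>j<?e. of_int (n j) *\<^sub>R (vec_of_int (b j) :: real^'d))"
      if "v \<in> lattice_of L" for v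
    proof -
      have "v \<in> g ` extensional {..<?e}"
        using bij_betw_imp_surj_on[OF g_bij] that by simp
      then obtain n where "n \<in> extensional {..<?e}" "v = g n"
        by blast
      then have "v = A n"
        by (simp add: A_def extensional_restrict)
      then show ?thesis using A_eq by blast
    qed
    show "n j = 0"
      if "(\<Sum>j<?e. of_int (n j) *\<^sub>R (vec_of_int (b j) :: real^'d)) = 0" "j < ?e" for n j
    proof -
      have "vec_of_int (A n) = (0 :: real^'d)" "vec_of_int (A (\<lambda>i. 0)) = (0 :: real^'d)"
        using that by (simp_all add: A_eq)
      then have "A n = A (\<lambda>i. 0)"
        by (metis vec_of_int_inject)
      then have "restrict n {..<?e} = restrict (\<lambda>i. 0) {..<?e}"
        using g_bij unfolding A_def bij_betw_def by (auto dest!: inj_onD)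
      then show ?thesis
        using that(2) by (metis lessThan_iff restrict_apply')
    qed
  qed
qed

text \<open>The reals are a vector space over the rationals, so \<open>c\<close> extends to a basis.\<close>

lemma rational_functional_nonzero:
  fixes c :: real
  assumes "c \<noteq> 0"
  obtains \<phi> :: "real \<Rightarrow> rat"
  where "\<phi> c \<noteq> 0" "\<And>x y. \<phi> (x + y) = \<phi> x + \<phi> y" "\<And>q x. \<phi> (of_rat q * x) = q * \<phi> x"
proof -
  interpret vector_space_pair "\<lambda>(q::rat) (x::real). of_rat q * x" "\<lambda>(q::rat) (x::rat). q * x"
    by unfold_locales (simp_all add: algebra_simps of_rat_add of_rat_mult)
  have "vs1.independent {c}"
    using assms by (simp add: vs1.dependent_single)
  then obtain \<phi> where lin: "Vector_Spaces.linear (\<lambda>(q::rat) (x::real). of_rat q * x) (\<lambda>(q::rat) (x::rat). q * x) \<phi>"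
    and val: "\<forall>x\<in>{c}. \<phi> x = 1"
    using linear_independent_extend[of "{c}" "\<lambda>_. 1"] by auto
  interpret Vector_Spaces.linear "\<lambda>(q::rat) (x::real). of_rat q * x" "\<lambda>(q::rat) (x::rat). q * x" \<phi>
    by (fact lin)
  show thesis
    by (rule that[of \<phi>]) (use val in \<open>auto simp: add scale\<close>)
qed

lemma common_denominator:
  fixes q :: "nat \<Rightarrow> rat"
  obtains N :: int and n :: "nat \<Rightarrow> int"
  where "N \<noteq> 0" "\<And>j. j < k \<Longrightarrow> of_int N * q j = of_int (n j)"
proof -
  define N where "N = (\<Prod>j<k. snd (quotient_of (q j)))"
  have nz: "snd (quotient_of (q j)) \<noteq> 0" for j
    by (metis less_irrefl quotient_of_denom_pos')
  have "\<exists>m. of_int N * q j = of_int m" if "j < k" for j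
  proof -
    have "q j = of_int (fst (quotient_of (q j))) / of_int (snd (quotient_of (q j)))"
      by (rule quotient_of_div) simp
    moreover have "N = snd (quotient_of (q j)) * (\<Prod>i\<in>{..<k} - {j}. snd (quotient_of (q i)))"
      unfolding N_def using that by (subst prod.remove[of _ j]) auto
    ultimately have "of_int N * q j
        = of_int (fst (quotient_of (q j)) * (\<Prod>i\<in>{..<k} - {j}. snd (quotient_of (q i))))"
      using nz[of j] by (simp add: field_simps)
    then show ?thesis by blast
  qed
  then obtain n where "\<And>j. j < k \<Longrightarrow> of_int N * q j = of_int (n j)" by metis
  moreover have "N \<noteq> 0" using nz by (simp add: N_def)
  ultimately show thesis using that by blast
qed

text \<open>A real relation between integer vectors is a system of relations with integer coefficients
  between the reals \<open>c j\<close>. A \<open>\<rat>\<close>-linear functional \<open>\<phi>\<close> on \<open>\<real>\<close> turns it into a rational relation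
  with coefficients \<open>\<phi> (c j)\<close>, nontrivial if \<open>\<phi>\<close> does not vanish on some chosen \<open>c i\<close>; clearing
  denominators gives a relation over \<open>\<int>\<close>.\<close>

lemma int_independent_imp_real_independent:
  fixes b :: "nat \<Rightarrow> int^'d"
  assumes indep: "\<And>n j. (\<Sum>j<k. of_int (n j) *\<^sub>R (vec_of_int (b j) :: real^'d)) = 0 \<Longrightarrow> j < k \<Longrightarrow> n j = 0"
    and zero: "(\<Sum>j<k. c j *\<^sub>R (vec_of_int (b j) :: real^'d)) = 0" and i: "i < k"
  shows "c i = 0"
proof (rule ccontr)
  assume "c i \<noteq> 0"
  then obtain \<phi> :: "real \<Rightarrow> rat" where \<phi>: "\<phi> (c i) \<noteq> 0" "\<And>x y. \<phi> (x + y) = \<phi> x + \<phi> y"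
    "\<And>q x. \<phi> (of_rat q * x) = q * \<phi> x"
    by (rule rational_functional_nonzero) blast
  have \<phi>0: "\<phi> 0 = 0" using \<phi>(2)[of 0 0] by simp
  have \<phi>sum: "\<phi> (\<Sum>j\<in>J. x j) = (\<Sum>j\<in>J. \<phi> (x j))" for J :: "nat set" and x
    by (induction J rule: infinite_finite_induct) (simp_all add: \<phi> \<phi>0)
  obtain N :: int and n where N: "N \<noteq> 0" "\<And>j. j < k \<Longrightarrow> of_int N * \<phi> (c j) = of_int (n j)"
    by (rule common_denominator[of k "\<lambda>j. \<phi> (c j)"]) blast
  have int_sum: "(\<Sum>j<k. n j * b j $ s) = 0" for s
  proof -
    have "(\<Sum>j<k. of_int (b j $ s) * c j) = 0"
      using arg_cong[OF zero, of "\<lambda>v. v $ s"] by (simp add: mult.commute)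
    then have "\<phi> (\<Sum>j<k. of_rat (of_int (b j $ s)) * c j) = 0"
      by (simp add: \<phi>0)
    then have "(\<Sum>j<k. \<phi> (of_rat (of_int (b j $ s)) * c j)) = 0"
      by (simp only: \<phi>sum)
    then have "(\<Sum>j<k. of_int (b j $ s) * \<phi> (c j)) = 0"
      by (simp only: \<phi>)
    then have "of_int N * (\<Sum>j<k. of_int (b j $ s) * \<phi> (c j)) = 0"
      by simp
    then have "(\<Sum>j<k. (of_int N * \<phi> (c j)) * of_int (b j $ s)) = 0"
      by (simp add: sum_distrib_left mult_ac)
    then have "of_int (\<Sum>j<k. n j * b j $ s) = (0::rat)"
      by (simp add: N(2))
    then show ?thesis by (simp only: of_int_eq_0_iff)
  qed
  have "(\<Sum>j<k. real_of_int (n j) * of_int (b j $ s)) = 0" for s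
  proof -
    have "real_of_int (\<Sum>j<k. n j * b j $ s) = 0"
      by (simp only: int_sum of_int_0)
    then show ?thesis by simp
  qed
  then have "(\<Sum>j<k. of_int (n j) *\<^sub>R (vec_of_int (b j) :: real^'d)) = 0"
    by (simp add: vec_eq_iff)
  then have "n i = 0" using indep i by blast
  then show False using N i \<phi>(1) by fastforce
qed

text \<open>The lattice basis is independent over \<open>\<real>\<close> and has \<open>dim L\<close> elements, so it spans \<open>L\<close>.\<close>

lemma completely_rational_basis:
  fixes L :: "(real^'d) set"
  assumes L: "subspace L" and rational: "completely_rational L"
  obtains B :: "(real^'d) set"
  where "finite B" "independent B" "span B = L" "\<And>v. v \<in> B \<Longrightarrow> \<exists>m\<in>lattice_of L. v = vec_of_int m"
    and "\<And>m. m \<in> lattice_of L \<Longrightarrow> \<exists>n. vec_of_int m = (\<Sum>v\<in>B. of_int (n v) *\<^sub>R v)"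
proof -
  obtain b :: "nat \<Rightarrow> int^'d" where b: "\<And>j. j < dim L \<Longrightarrow> b j \<in> lattice_of L"
     "\<And>v. v \<in> lattice_of L \<Longrightarrow>
           \<exists>n. vec_of_int v = (\<Sum>j<dim L. of_int (n j) *\<^sub>R vec_of_int (b j))"
     "\<And>n j. (\<Sum>j<dim L. of_int (n j) *\<^sub>R (vec_of_int (b j) :: real^'d)) = 0 \<Longrightarrow> j < dim L \<Longrightarrow> n j = 0"
    by (rule completely_rational_coordinates[OF assms]) blast
  define w :: "nat \<Rightarrow> real^'d" where "w j = vec_of_int (b j)" for j
  define B where "B = w ` {..<dim L}"
  have c0: "c i = 0" if "(\<Sum>j<dim L. c j *\<^sub>R w j) = 0" "i < dim L" for c i
    using int_independent_imp_real_independent[where k = "dim L" and b = b and c = c and i = i] b(3) that unfolding w_def by blast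
  have inj: "inj_on w {..<dim L}"
  proof (rule inj_onI, rule ccontr)
    fix i j assume ij: "i \<in> {..<dim L}" "j \<in> {..<dim L}" "w i = w j" "i \<noteq> j"
    have "(\<Sum>k<dim L. (of_bool (k = i) - of_bool (k = j)) *\<^sub>R w k)
        = (\<Sum>k<dim L. (of_bool (k = i)) *\<^sub>R w k) - (\<Sum>k<dim L. (of_bool (k = j)) *\<^sub>R w k)"
      by (simp add: scaleR_diff_left sum_subtractf)
    also have "\<dots> = 0"
      using ij by (simp add: of_bool_def if_distrib[of "\<lambda>x. x *\<^sub>R _"] sum.delta cong: if_cong)
    finally show False using c0[of "\<lambda>k. of_bool (k = i) - of_bool (k = j)" i] ij by auto
  qed
  have fin: "finite B" by (simp add: B_def)
  have indep: "independent B"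
    unfolding independent_explicit_finite_subsets
  proof (intro allI impI ballI)
    fix S u v assume S: "S \<subseteq> B" "finite S" "(\<Sum>v\<in>S. u v *\<^sub>R v) = 0" "v \<in> S"
    define c where "c j = (if w j \<in> S then u (w j) else 0)" for j
    have "(\<Sum>j<dim L. c j *\<^sub>R w j) = (\<Sum>v\<in>B. (if v \<in> S then u v else 0) *\<^sub>R v)"
      unfolding B_def by (subst sum.reindex[OF inj]) (simp add: c_def)
    also have "\<dots> = (\<Sum>v\<in>S. u v *\<^sub>R v)"
      by (rule sum.mono_neutral_cong_right) (use S fin in auto)
    finally have "\<And>i. i < dim L \<Longrightarrow> c i = 0" using c0 S by simp
    moreover obtain i where "i < dim L" "v = w i"
      using S by (auto simp: B_def)
    ultimately have "c i = 0" "v = w i" by blast+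
    then show "u v = 0" using S(4) by (simp add: c_def)
  qed
  have sub: "B \<subseteq> L"
    using b(1) by (auto simp: B_def w_def lattice_of_def)
  have card: "card B = dim L"
    by (simp add: B_def card_image[OF inj])
  have "L \<subseteq> span B"
    by (rule card_ge_dim_independent[OF sub indep]) (simp add: card)
  then have "span B = L"
    using sub L by (simp add: span_minimal subset_antisym)
  moreover have "\<exists>n. vec_of_int m = (\<Sum>v\<in>B. of_int (n v) *\<^sub>R v)" if m: "m \<in> lattice_of L" for m
  proof -
    obtain n where "vec_of_int m = (\<Sum>j<dim L. of_int (n j) *\<^sub>R w j)"
      using b(2)[OF m] by (auto simp: w_def)
    also have "\<dots> = (\<Sum>v\<in>B. of_int (n (the_inv_into {..<dim L} w v)) *\<^sub>R v)"
      unfolding B_def by (subst sum.reindex[OF inj]) (simp add: the_inv_into_f_f[OF inj])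
    finally show ?thesis
      by (rule exI[of _ "\<lambda>v. n (the_inv_into {..<dim L} w v)"])
  qed
  moreover have "\<exists>m\<in>lattice_of L. v = vec_of_int m" if "v \<in> B" for v
    using that b(1) by (auto simp: B_def w_def)
  ultimately show thesis using that fin indep by blast
qed

lemma lattice_of_sum:
  assumes L: "subspace L" and B: "finite B" "\<And>v. v \<in> B \<Longrightarrow> \<exists>m\<in>lattice_of L. v = vec_of_int m"
  shows "\<exists>m\<in>lattice_of L. (\<Sum>v\<in>B. of_int (n v) *\<^sub>R v) = vec_of_int m"
proof -
  obtain g where g: "\<And>v. v \<in> B \<Longrightarrow> g v \<in> lattice_of L \<and> v = vec_of_int (g v)"
    using B(2) by metis
  define m where "m = (\<chi> i. \<Sum>v\<in>B. n v * g v $ i)"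
  have "v $ i = of_int (g v $ i)" if "v \<in> B" for v i
    using g[OF that] vec_of_int_nth by metis
  then have "(\<Sum>v\<in>B. of_int (n v) *\<^sub>R v) = vec_of_int m"
    by (simp add: vec_eq_iff m_def)
  moreover have "(\<Sum>v\<in>B. of_int (n v) *\<^sub>R v) \<in> L"
  proof (intro subspace_sum[OF L] subspace_scale[OF L])
    show "v \<in> L" if "v \<in> B" for v
      using B(2)[OF that] by (auto simp: lattice_of_def)
  qed
  ultimately show ?thesis by (auto simp: lattice_of_def)
qed

section \<open>Integer vectors off the subspace keep their distance\<close>

lemma finite_bounded_int_vectors: "finite {m :: int^'d. norm (vec_of_int m :: real^'d) \<le> C}"
proof (rule finite_subset)
  show "{m :: int^'d. norm (vec_of_int m :: real^'d) \<le> C}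
      \<subseteq> vec_lambda ` (PiE UNIV (\<lambda>_. {-\<lceil>C\<rceil>..\<lceil>C\<rceil>}))"
  proof
    fix m :: "int^'d" assume "m \<in> {m. norm (vec_of_int m :: real^'d) \<le> C}"
    then have "\<bar>real_of_int (m $ i)\<bar> \<le> C" for i
      using component_le_norm_cart[of "vec_of_int m" i] by auto
    then have "\<bar>m $ i\<bar> \<le> \<lceil>C\<rceil>" for i
      using order_trans[OF _ le_of_int_ceiling[of C]] by (metis of_int_abs of_int_le_iff)
    then have "vec_nth m \<in> PiE UNIV (\<lambda>_. {-\<lceil>C\<rceil>..\<lceil>C\<rceil>})"
      by (auto simp: abs_le_iff minus_le_iff)
    then show "m \<in> vec_lambda ` (PiE UNIV (\<lambda>_. {-\<lceil>C\<rceil>..\<lceil>C\<rceil>}))"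
      by (metis image_eqI vec_nth_inverse)
  qed
  show "finite (vec_lambda ` (PiE (UNIV::'d set) (\<lambda>_. {-\<lceil>C\<rceil>..\<lceil>C\<rceil>})))"
    by (intro finite_imageI finite_PiE) auto
qed

text \<open>Round down the coordinates with respect to the lattice basis.\<close>

lemma lattice_of_cocompact:
  fixes L :: "(real^'d) set"
  assumes L: "subspace L" and rational: "completely_rational L"
  obtains C where "\<And>v. v \<in> L \<Longrightarrow> \<exists>m\<in>lattice_of L. norm (v - vec_of_int m) \<le> C"
proof -
  obtain B :: "(real^'d) set" where B: "finite B" "independent B" "span B = L"
    "\<And>v. v \<in> B \<Longrightarrow> \<exists>m\<in>lattice_of L. v = vec_of_int m"
    "\<And>m. m \<in> lattice_of L \<Longrightarrow> \<exists>n. vec_of_int m = (\<Sum>v\<in>B. of_int (n v) *\<^sub>R v)"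
    by (rule completely_rational_basis[OF assms]) blast
  have "\<exists>m\<in>lattice_of L. norm (v - vec_of_int m) \<le> (\<Sum>u\<in>B. norm u)" if v: "v \<in> L" for v
  proof -
    obtain c where c: "v = (\<Sum>u\<in>B. c u *\<^sub>R u)"
      using v B by (auto simp: span_finite[OF B(1)])
    obtain m where m: "m \<in> lattice_of L" "(\<Sum>u\<in>B. of_int \<lfloor>c u\<rfloor> *\<^sub>R u) = vec_of_int m"
      using lattice_of_sum[OF L B(1) B(4), of "\<lambda>u. \<lfloor>c u\<rfloor>"] by blast
    have "v - vec_of_int m = (\<Sum>u\<in>B. frac (c u) *\<^sub>R u)"
      by (simp add: c m(2)[symmetric] sum_subtractf[symmetric] scaleR_diff_left[symmetric] frac_def)
    also have "norm \<dots> \<le> (\<Sum>u\<in>B. norm u)"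
    proof (rule sum_norm_le)
      show "norm (frac (c u) *\<^sub>R u) \<le> norm u" for u
        using frac_ge_0[of "c u"] frac_lt_1[of "c u"] by (simp add: mult_left_le_one_le)
    qed
    finally show ?thesis using m by blast
  qed
  then show thesis using that by blast
qed

text \<open>An integer vector close to \<open>L\<close> can be moved by an element of the lattice into a fixed ball
  without changing its distance to \<open>L\<close>, because the lattice is cocompact. The ball contains only
  finitely many integer vectors, so those not in \<open>L\<close> have a smallest distance to \<open>L\<close>.\<close>

lemma completely_rational_gap:
  fixes L :: "(real^'d) set"
  assumes L: "subspace L" and rational: "completely_rational L"
  obtains \<epsilon> where "\<epsilon> > 0"
    and "\<And>m v. v \<in> L \<Longrightarrow> norm (vec_of_int m - v) < \<epsilon> \<Longrightarrow> m \<in> lattice_of L"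
proof -
  obtain C where C: "\<And>v. v \<in> L \<Longrightarrow> \<exists>m\<in>lattice_of L. norm (v - vec_of_int m) \<le> C"
    by (rule lattice_of_cocompact[OF assms]) blast
  define S where "S = {m :: int^'d. norm (vec_of_int m :: real^'d) \<le> C + 1} - lattice_of L"
  have fin: "finite S"
    unfolding S_def using finite_bounded_int_vectors by blast
  have closed: "closed L" "L \<noteq> {}"
    using L subspace_0[OF L] by (auto simp: closed_subspace)
  have pos: "0 < infdist (vec_of_int m) L" if "m \<in> S" for m :: "int^'d"
    using that closed in_closed_iff_infdist_zero[OF closed, of "vec_of_int m"] infdist_nonneg[of "vec_of_int m" L]
    by (auto simp: S_def lattice_of_def less_le)
  define \<epsilon> where "\<epsilon> = Min (insert 1 ((\<lambda>m. infdist (vec_of_int m) L) ` S))"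
  show thesis
  proof
    show "\<epsilon> > 0" using fin pos by (auto simp: \<epsilon>_def)
    fix m :: "int^'d" and v assume v: "v \<in> L" "norm (vec_of_int m - v) < \<epsilon>"
    obtain n where n: "n \<in> lattice_of L" "norm (v - vec_of_int n) \<le> C" using C v by blast
    have e1: "\<epsilon> \<le> 1" using fin by (simp add: \<epsilon>_def)
    have "vec_of_int (m - n) = (vec_of_int m - v) + (v - vec_of_int n)"
      by (simp add: vec_of_int_diff)
    then have "norm (vec_of_int (m - n) :: real^'d) \<le> C + 1"
      using norm_triangle_ineq[of "vec_of_int m - v" "v - vec_of_int n"] n v e1 by simp
    moreover have "infdist (vec_of_int (m - n)) L < \<epsilon>"
    proof -
      have "infdist (vec_of_int (m - n)) L \<le> dist (vec_of_int (m - n)) (v - vec_of_int n)"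
        using v n by (intro infdist_le subspace_diff[OF L]) (auto simp: lattice_of_def)
      also have "\<dots> = norm (vec_of_int m - v)"
        by (simp add: dist_norm vec_of_int_diff)
      finally show ?thesis using v by simp
    qed
    moreover have "\<epsilon> \<le> infdist (vec_of_int (m - n)) L" if "m - n \<in> S"
      using fin that by (simp add: \<epsilon>_def)
    ultimately have "m - n \<in> lattice_of L" by (force simp: S_def)
    then have "vec_of_int ((m - n) + n) \<in> L"
      using n subspace_add[OF L] unfolding vec_of_int_add by (simp add: lattice_of_def)
    then show "m \<in> lattice_of L" by (simp add: lattice_of_def)
  qed
qed

section \<open>Characters of the lattice\<close>

text \<open>The arguments of the values on a lattice basis can be prescribed by a linear functional, since
  the basis is independent over \<open>\<real>\<close>. Only the component in \<open>L\<close> of the vector representing this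
  functional matters on the lattice.\<close>

lemma character_on_lattice:
  fixes L :: "(real^'d) set"
  assumes L: "subspace L" and rational: "completely_rational L"
    and \<kappa>: "character_on (lattice_of L) \<kappa>"
  obtains l where "l \<in> L"
    and "\<And>n. n \<in> lattice_of L \<Longrightarrow> \<kappa> n = plane_wave l (vec_of_int n)"
proof -
  obtain B :: "(real^'d) set" where B: "finite B" "independent B" "span B = L"
    "\<And>v. v \<in> B \<Longrightarrow> \<exists>m\<in>lattice_of L. v = vec_of_int m"
    "\<And>m. m \<in> lattice_of L \<Longrightarrow> \<exists>n. vec_of_int m = (\<Sum>v\<in>B. of_int (n v) *\<^sub>R v)"
    by (rule completely_rational_basis[OF assms(1,2)]) blast
  obtain g where g: "\<And>v. v \<in> B \<Longrightarrow> g v \<in> lattice_of L \<and> v = vec_of_int (g v)"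
    using B(4) by metis
  define \<theta> where "\<theta> v = Arg (\<kappa> (g v)) / (2 * pi)" for v
  obtain \<psi> :: "real^'d \<Rightarrow> real" where \<psi>: "linear \<psi>" "\<And>v. v \<in> B \<Longrightarrow> \<psi> v = \<theta> v"
    using linear_independent_extend[OF B(2), of \<theta>] by auto
  define a where "a = adjoint \<psi> 1"
  have a: "\<psi> v = a \<bullet> v" for v
    using adjoint_works[OF \<psi>(1), where x = v and y = 1] by (simp add: a_def inner_commute)
  obtain l z where lz: "l \<in> span L" "\<And>w. w \<in> span L \<Longrightarrow> orthogonal z w" "a = l + z"
    using orthogonal_subspace_decomp_exists[of L a] by metis
  have lL: "l \<in> L" using lz L by (simp add: span_eq_iff[THEN iffD2])
  have l: "l \<bullet> v = \<psi> v" if "v \<in> L" for v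
    using lz(2)[OF span_base[OF that]] by (simp add: a lz(3) inner_add_left orthogonal_def)
  define E where "E n = plane_wave l (vec_of_int n)" for n :: "int^'d"
  have E_add: "E (m + n) = E m * E n" for m n
    by (simp add: E_def vec_of_int_add plane_wave_add)
  (* K is a subgroup of the lattice, so it suffices that it contains the basis. *)
  define K where "K = {n \<in> lattice_of L. \<kappa> n = E n}"
  have E0: "E 0 = 1" by (simp add: E_def)
  have E_nz: "E n \<noteq> 0" for n by (simp add: E_def)
  have zero_in: "0 \<in> lattice_of L" using L by (simp add: lattice_of_def subspace_0)
  have \<kappa>_add: "\<kappa> (m + n) = \<kappa> m * \<kappa> n" if "m \<in> lattice_of L" "n \<in> lattice_of L" for m n
    using \<kappa> that by (simp add: character_on_def)
  have "norm (\<kappa> 0) = 1" using \<kappa> zero_in by (simp add: character_on_def)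
  then have \<kappa>0: "\<kappa> 0 = 1" using \<kappa>_add[OF zero_in zero_in] by fastforce
  have K_add: "m + n \<in> K" if "m \<in> K" "n \<in> K" for m n
    using that L \<kappa>_add by (auto simp: K_def E_add lattice_of_def vec_of_int_add subspace_add)
  have K_uminus: "- n \<in> K" if n: "n \<in> K" for n
  proof -
    have neg: "- n \<in> lattice_of L"
      using lattice_of_diff[OF L zero_in, of n] n by (simp add: K_def)
    have "E n * \<kappa> (- n) = E n * E (- n)"
      using \<kappa>_add[of n "- n"] neg n by (simp add: K_def \<kappa>0 E_add[symmetric] E0)
    then show ?thesis using neg E_nz by (simp add: K_def)
  qed
  have K0: "0 \<in> K" using zero_in by (simp add: K_def E0 \<kappa>0)
  have K_basis: "g v \<in> K" if v: "v \<in> B" for v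
  proof -
    have "norm (\<kappa> (g v)) = 1" using \<kappa> g v by (simp add: character_on_def)
    then have "\<kappa> (g v) = exp (\<i> * of_real (Arg (\<kappa> (g v))))"
      using Arg_eq[of "\<kappa> (g v)"] by fastforce
    also have "vec_of_int (g v) = v" "v \<in> L"
      using g[OF v] B(3) span_base[OF v] by auto
    then have "l \<bullet> vec_of_int (g v) = \<theta> v"
      using l[of v] \<psi>(2)[OF v] by simp
    then have "exp (\<i> * of_real (Arg (\<kappa> (g v)))) = E (g v)"
      by (simp add: E_def plane_wave_def \<theta>_def mult_ac)
    finally show ?thesis using g[OF v] by (simp add: K_def)
  qed
  have K_comb: "\<exists>m\<in>K. vec_of_int m = (\<Sum>v\<in>S. of_int (n v) *\<^sub>R v)" if "finite S" "S \<subseteq> B" for S n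
    using that
  proof (induction S rule: finite_induct)
    case empty
    then show ?case using K0 by force
  next
    case (insert v S)
    then obtain m where m: "m \<in> K" "vec_of_int m = (\<Sum>v\<in>S. of_int (n v) *\<^sub>R v)" by auto
    have "\<exists>k\<in>K. vec_of_int k = of_int c *\<^sub>R v" for c
    proof (induction c rule: int_induct[where k = 0])
      case base
      then show ?case using K0 by force
    next
      case (step1 c)
      then obtain k where "k \<in> K" "vec_of_int k = of_int c *\<^sub>R v" by blast
      then show ?case using K_add[OF _ K_basis, of k v] g[of v] insert
        by (intro bexI[of _ "k + g v"]) (auto simp: vec_of_int_add scaleR_add_left)
    next
      case (step2 c)
      then obtain k where "k \<in> K" "vec_of_int k = of_int c *\<^sub>R v" by blast
      then show ?case using K_add[OF _ K_uminus[OF K_basis], of k v] g[of v] insert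
        by (intro bexI[of _ "k - g v"]) (auto simp: vec_of_int_diff scaleR_diff_left)
    qed
    then obtain k where "k \<in> K" "vec_of_int k = of_int (n v) *\<^sub>R v" by blast
    then show ?case using m K_add insert
      by (intro bexI[of _ "k + m"]) (auto simp: vec_of_int_add)
  qed
  have "n \<in> K" if "n \<in> lattice_of L" for n
    using B(5)[OF that] K_comb[OF B(1) order_refl] vec_of_int_inject by metis
  then show thesis using that[OF lL] by (auto simp: K_def E_def)
qed

section \<open>The suspension space and measure preserving actions\<close>

lemma unit_cube_lmeasurable: "(unit_cube :: (real^'d) set) \<in> lmeasurable"
proof (rule bounded_set_imp_lmeasurable)
  have "unit_cube \<subseteq> cbox (0 :: real^'d) 1"
    by (auto simp: unit_cube_def mem_box_cart less_imp_le)
  then show "bounded (unit_cube :: (real^'d) set)"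
    using bounded_cbox bounded_subset by blast
  have cube_eq: "unit_cube = (\<Inter>i. {r :: real^'d. 0 \<le> r $ i} \<inter> {r. r $ i < 1})"
    by (auto simp: unit_cube_def)
  have "closed {r :: real^'d. 0 \<le> r $ i}" "open {r :: real^'d. r $ i < 1}" for i
    by (intro closed_Collect_le open_Collect_less continuous_intros)+
  then have "(unit_cube :: (real^'d) set) \<in> sets borel"
    unfolding cube_eq by (intro sets.finite_INT sets.Int borel_closed borel_open) auto
  then show "(unit_cube :: (real^'d) set) \<in> sets lebesgue"
    by simp
qed

lemma finite_measure_unit_cube: "finite_measure (lebesgue_on (unit_cube :: (real^'d) set))"
  by (rule finite_measure_lebesgue_on[OF unit_cube_lmeasurable])

lemma pair_sigma_finite_suspension:
  assumes "prob_space M"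
  shows "pair_sigma_finite M (lebesgue_on (unit_cube :: (real^'d) set))"
  by (simp add: assms pair_sigma_finite.intro prob_space_imp_sigma_finite finite_measure_unit_cube
      finite_measure.axioms(1))

text \<open>For eigenvalue equations of the suspension, which are known to hold outside some null set while
  the set of their solutions is not known to be measurable.\<close>

lemma (in pair_sigma_finite) AE_pair_snd:
  assumes "AE z in M1 \<Otimes>\<^sub>M M2. Q z"
  shows "AE y in M2. AE x in M1. Q (x, y)"
proof -
  interpret Q: pair_sigma_finite M2 M1 ..
  have "AE z in distr (M2 \<Otimes>\<^sub>M M1) (M1 \<Otimes>\<^sub>M M2) (\<lambda>(y, x). (x, y)). Q z"
    using assms by (simp only: distr_pair_swap[symmetric])
  then have "AE z in M2 \<Otimes>\<^sub>M M1. Q (case z of (y, x) \<Rightarrow> (x, y))"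
    by (rule AE_distrD[OF measurable_pair_swap'])
  from Q.AE_pair[OF this] show ?thesis by simp
qed

lemma (in pair_sigma_finite) AE_pair_fstI:
  assumes "AE x in M1. Q x"
  shows "AE z in M1 \<Otimes>\<^sub>M M2. Q (fst z)"
proof -
  obtain A where A: "{x \<in> space M1. \<not> Q x} \<subseteq> A" "emeasure M1 A = 0" "A \<in> sets M1"
    using assms by (rule AE_E)
  show ?thesis
  proof (rule AE_I)
    show "{z \<in> space (M1 \<Otimes>\<^sub>M M2). \<not> Q (fst z)} \<subseteq> A \<times> space M2"
      using A(1) by (auto simp: space_pair_measure)
    show "emeasure (M1 \<Otimes>\<^sub>M M2) (A \<times> space M2) = 0"
      using A by (simp add: M2.emeasure_pair_measure_Times)
    show "A \<times> space M2 \<in> sets (M1 \<Otimes>\<^sub>M M2)"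
      using A by simp
  qed
qed

lemma action_measurable:
  assumes "free_mp_action M UNIV T"
  shows "T g \<in> measurable M M"
  using assms by (simp add: free_mp_action_def)

lemma action_distr:
  assumes "free_mp_action M UNIV T"
  shows "distr M M (T g) = M"
  using assms by (simp add: free_mp_action_def)

lemma action_add:
  assumes "free_mp_action M UNIV T" "x \<in> space M"
  shows "T (g + h) x = T g (T h x)"
  using assms by (simp add: free_mp_action_def)

lemma action_zero:
  assumes "free_mp_action M UNIV T" "x \<in> space M"
  shows "T 0 x = x"
  using assms by (simp add: free_mp_action_def)

lemma AE_action:
  assumes "free_mp_action M UNIV T" "AE x in M. Q x"
  shows "AE x in M. Q (T g x)"
  by (rule AE_distrD[OF action_measurable[OF assms(1)]]) (simp only: action_distr[OF assms(1)] assms(2))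

lemma integral_action:
  fixes f :: "'a \<Rightarrow> complex"
  assumes "free_mp_action M UNIV T" "f \<in> borel_measurable M"
  shows "(LINT x|M. f (T g x)) = (LINT x|M. f x)"
  using integral_distr[OF action_measurable[OF assms(1)], of f g] assms by (simp add: action_distr)

lemma nn_integral_action:
  assumes "free_mp_action M UNIV T" "f \<in> borel_measurable M"
  shows "(\<integral>\<^sup>+x. f (T g x) \<partial>M) = (\<integral>\<^sup>+x. f x \<partial>M)"
  using nn_integral_distr[OF action_measurable[OF assms(1)], of f g] assms by (simp add: action_distr)

lemma (in finite_measure) L2_imp_integrable:
  assumes "f \<in> L2 M"
  shows "integrable M f"
proof (rule Bochner_Integration.integrable_bound)
  show "integrable M (\<lambda>x. 1 + (norm (f x))\<^sup>2)"
    using assms by (simp add: L2_def)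
  show "f \<in> borel_measurable M"
    using assms by (simp add: L2_def)
  have "norm (f x) \<le> 1 + (norm (f x))\<^sup>2" for x
    using sum_power2_ge_zero[of "norm (f x) - 1" "norm (f x)"]
    by (simp add: power2_eq_square algebra_simps)
  then show "AE x in M. norm (f x) \<le> norm (1 + (norm (f x))\<^sup>2)"
    by simp
qed

section \<open>Eigenfunctions of mean zero\<close>

definition mean_zero_eigenfunction ::
    "'a measure \<Rightarrow> 'g::ab_group_add set \<Rightarrow> ('g \<Rightarrow> 'a \<Rightarrow> 'a) \<Rightarrow> ('g \<Rightarrow> complex) \<Rightarrow> ('a \<Rightarrow> complex) \<Rightarrow> bool"
where
  "mean_zero_eigenfunction M G T \<kappa> f \<longleftrightarrow>
     f \<in> L2 M \<and> (LINT x|M. f x) = 0 \<and> L2_nonzero M f \<and>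
     (\<forall>g\<in>G. AE x in M. f (T g x) = \<kappa> g * f x)"

lemma mean_zero_eigenfunction_not_constant:
  assumes "prob_space M" and f: "mean_zero_eigenfunction M G T \<kappa> f"
  shows "\<not> L2_constant M f"
proof
  interpret prob_space M by fact
  assume "L2_constant M f"
  then obtain c where c: "AE x in M. f x = c" by (auto simp: L2_constant_def)
  have "f \<in> borel_measurable M" "(LINT x|M. f x) = 0"
    using f by (auto simp: mean_zero_eigenfunction_def L2_def)
  then have "0 = (LINT x|M. c)"
    using integral_cong_AE[of f M "\<lambda>_. c"] c by simp
  then have "c = 0" by (simp add: prob_space)
  then show False
    using f c by (simp add: mean_zero_eigenfunction_def L2_nonzero_def)
qed

text \<open>Integrating the eigenvalue equation gives \<open>m = \<kappa> g * m\<close> for the mean \<open>m\<close> of \<open>f\<close>, so subtracting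
  \<open>m\<close> preserves the equation, whether \<open>m\<close> is zero or \<open>\<kappa>\<close> is trivial. With this, triviality of all
  eigenfunctions can be expressed as absence of eigenfunctions of mean zero.\<close>

lemma mean_zero_eigenfunction_center:
  assumes M: "prob_space M" and T: "free_mp_action M UNIV T"
    and f: "f \<in> L2 M" "\<not> L2_constant M f"
    and eigen: "\<And>g. g \<in> G \<Longrightarrow> AE x in M. f (T g x) = \<kappa> g * f x"
  shows "mean_zero_eigenfunction M G T \<kappa> (\<lambda>x. f x - (LINT y|M. f y))"
proof -
  interpret prob_space M by fact
  define m where "m = (LINT y|M. f y)"
  have f_meas [measurable]: "f \<in> borel_measurable M" and f_sq: "integrable M (\<lambda>x. (norm (f x))\<^sup>2)"
    using f by (auto simp: L2_def)
  have f_int: "integrable M f" by (rule L2_imp_integrable[OF f(1)])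
  have fT_meas [measurable]: "(\<lambda>x. f (T g x)) \<in> borel_measurable M" for g
    using measurable_compose[OF action_measurable[OF T] f_meas] .
  have "integrable M (\<lambda>x. (norm (f x - m))\<^sup>2)"
  proof (rule Bochner_Integration.integrable_bound)
    show "integrable M (\<lambda>x. 2 * (norm (f x))\<^sup>2 + 2 * (norm m)\<^sup>2)"
      using f_sq by simp
    have "(norm (f x - m))\<^sup>2 \<le> 2 * (norm (f x))\<^sup>2 + 2 * (norm m)\<^sup>2" for x
    proof -
      have "(norm (f x - m))\<^sup>2 \<le> (norm (f x) + norm m)\<^sup>2"
        by (intro power_mono norm_triangle_ineq4) simp
      also have "\<dots> \<le> 2 * (norm (f x))\<^sup>2 + 2 * (norm m)\<^sup>2"
        using zero_le_power2[of "norm (f x) - norm m"] by (simp add: power2_eq_square algebra_simps)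
      finally show ?thesis .
    qed
    then show "AE x in M. norm ((norm (f x - m))\<^sup>2) \<le> norm (2 * (norm (f x))\<^sup>2 + 2 * (norm m)\<^sup>2)"
      by simp
  qed measurable
  then have "(\<lambda>x. f x - m) \<in> L2 M" by (simp add: L2_def)
  moreover have "(LINT x|M. f x - m) = 0"
    using f_int by (simp add: m_def prob_space)
  moreover have "L2_nonzero M (\<lambda>x. f x - m)"
    using f(2) by (auto simp: L2_nonzero_def L2_constant_def)
  moreover have "AE x in M. f (T g x) - m = \<kappa> g * (f x - m)" if g: "g \<in> G" for g
  proof -
    have "m = (LINT x|M. f (T g x))"
      by (simp add: m_def integral_action[OF T f_meas])
    also have "\<dots> = (LINT x|M. \<kappa> g * f x)"
      by (rule integral_cong_AE) (use eigen[OF g] in measurable)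
    finally have "m = \<kappa> g * m" by (simp add: m_def)
    with eigen[OF g] show ?thesis
      by (auto elim!: eventually_mono simp: right_diff_distrib)
  qed
  ultimately show ?thesis by (simp add: mean_zero_eigenfunction_def m_def)
qed

lemma ergodic_action_iff_mean_zero:
  assumes M: "prob_space M" and T: "free_mp_action M UNIV T"
  shows "ergodic_action M G T \<longleftrightarrow> (\<nexists>f. mean_zero_eigenfunction M G T (\<lambda>_. 1) f)"
proof
  assume erg: "ergodic_action M G T"
  show "\<nexists>f. mean_zero_eigenfunction M G T (\<lambda>_. 1) f"
  proof
    assume "\<exists>f. mean_zero_eigenfunction M G T (\<lambda>_. 1) f"
    then obtain f where f: "mean_zero_eigenfunction M G T (\<lambda>_. 1) f" ..
    then have "f \<in> L2 M" "invariant_function M G T f"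
      by (auto simp: mean_zero_eigenfunction_def invariant_function_def)
    then show False
      using erg mean_zero_eigenfunction_not_constant[OF M f] by (auto simp: ergodic_action_def)
  qed
next
  assume none: "\<nexists>f. mean_zero_eigenfunction M G T (\<lambda>_. 1) f"
  show "ergodic_action M G T"
    unfolding ergodic_action_def
  proof (intro ballI impI, rule ccontr)
    fix f assume f: "f \<in> L2 M" "invariant_function M G T f" "\<not> L2_constant M f"
    have "AE x in M. f (T g x) = 1 * f x" if "g \<in> G" for g
      using f(2) that by (simp add: invariant_function_def)
    from mean_zero_eigenfunction_center[OF M T f(1,3) this] none show False by blast
  qed
qed

lemma weak_mixing_action_iff_mean_zero:
  assumes M: "prob_space M" and T: "free_mp_action M UNIV T"
  shows "weak_mixing_action M G T \<longleftrightarrow>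
    (\<nexists>\<kappa> f. character_on G \<kappa> \<and> mean_zero_eigenfunction M G T \<kappa> f)"
proof
  assume wm: "weak_mixing_action M G T"
  show "\<nexists>\<kappa> f. character_on G \<kappa> \<and> mean_zero_eigenfunction M G T \<kappa> f"
  proof (intro notI, elim exE conjE)
    fix \<kappa> f assume \<kappa>: "character_on G \<kappa>" and f: "mean_zero_eigenfunction M G T \<kappa> f"
    then have "f \<in> L2 M" "eigenfunction M G T f"
      by (auto simp: mean_zero_eigenfunction_def eigenfunction_def)
    then show False
      using wm mean_zero_eigenfunction_not_constant[OF M f] by (auto simp: weak_mixing_action_def)
  qed
next
  assume none: "\<nexists>\<kappa> f. character_on G \<kappa> \<and> mean_zero_eigenfunction M G T \<kappa> f"
  show "weak_mixing_action M G T"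
    unfolding weak_mixing_action_def
  proof (intro ballI impI, rule ccontr)
    fix f assume f: "f \<in> L2 M" "eigenfunction M G T f" "\<not> L2_constant M f"
    from f(2) obtain \<kappa> where \<kappa>: "character_on G \<kappa>"
      and eigen: "\<And>g. g \<in> G \<Longrightarrow> AE x in M. f (T g x) = \<kappa> g * f x"
      unfolding eigenfunction_def by blast
    from mean_zero_eigenfunction_center[OF M T f(1,3) eigen] \<kappa> none show False by blast
  qed
qed

section \<open>From the suspension to the base\<close>

text \<open>Restrict \<open>F\<close> to a fibre \<open>r = const\<close>. For times in the lattice the fibre coordinate does not
  move, so Fubini's theorem makes almost every restriction an eigenfunction of \<open>T\<close>.\<close>

lemma slice_eigenfunction:
  fixes T :: "int^'d \<Rightarrow> 'a \<Rightarrow> 'a" and L :: "(real^'d) set"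
  assumes M: "prob_space M" and F: "F \<in> L2_orth_cube M"
    and nonzero: "L2_nonzero (suspension_space M) F" and eigen: "eigen_equation M T L l F"
  obtains f where
    "mean_zero_eigenfunction M (lattice_of L) T (\<lambda>n. plane_wave l (vec_of_int n)) f"
proof -
  define N where "N = lebesgue_on (unit_cube :: (real^'d) set)"
  have S: "suspension_space M = M \<Otimes>\<^sub>M N"
    by (simp add: suspension_space_def N_def)
  interpret M: prob_space M by (fact M)
  interpret N: finite_measure N
    unfolding N_def by (rule finite_measure_unit_cube)
  interpret P: pair_sigma_finite M N
    unfolding N_def by (rule pair_sigma_finite_suspension[OF M])
  interpret S: finite_measure "M \<Otimes>\<^sub>M N"
    by (intro finite_measure_pair_measure M.finite_measure_axioms N.finite_measure_axioms)
  have F_L2: "F \<in> L2 (M \<Otimes>\<^sub>M N)"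
    using F by (simp add: L2_orth_cube_def S)
  then have F_meas [measurable]: "F \<in> borel_measurable (M \<Otimes>\<^sub>M N)"
    and F_sq: "integrable (M \<Otimes>\<^sub>M N) (\<lambda>z. (norm (F z))\<^sup>2)"
    by (simp_all add: L2_def)
  have F_int: "integrable (M \<Otimes>\<^sub>M N) F"
    by (rule S.L2_imp_integrable[OF F_L2])
  define g where "g r = (LINT x|M. F (x, r))" for r
  have g_meas [measurable]: "g \<in> borel_measurable N"
    unfolding g_def by measurable
  have g_int: "integrable N g"
    using P.integrable_snd[of "\<lambda>x r. F (x, r)"] F_int unfolding g_def by simp
  have sgn_meas [measurable]: "(\<lambda>r. sgn (g r)) \<in> borel_measurable N"
    unfolding sgn_div_norm by measurable
  have cnj_meas [measurable]: "cnj \<in> borel_measurable borel"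
    by (intro borel_measurable_continuous_onI continuous_intros)
  have sgn_L2: "(\<lambda>r. sgn (g r)) \<in> L2 N"
  proof -
    have "integrable N (\<lambda>r. (norm (sgn (g r)))\<^sup>2)"
      by (rule N.integrable_const_bound[of _ 1]) (auto simp: norm_sgn)
    then show ?thesis by (simp add: L2_def)
  qed
  \<comment> \<open>Orthogonality to the function \<open>sgn (g r)\<close>, which is bounded and hence square integrable, says that \<open>|g|\<close> has integral 0.\<close>
  have mean_zero: "AE r in N. g r = 0"
  proof -
    have int: "integrable (M \<Otimes>\<^sub>M N) (\<lambda>(x, r). F (x, r) * cnj (sgn (g r)))"
    proof (rule Bochner_Integration.integrable_bound[OF F_int])
      show "AE z in M \<Otimes>\<^sub>M N. norm (case z of (x, r) \<Rightarrow> F (x, r) * cnj (sgn (g r))) \<le> norm (F z)"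
        by (rule AE_I2) (auto simp: norm_mult norm_sgn split: prod.splits)
    qed measurable
    have "(\<lambda>(x, r). sgn (g r)) \<in> cube_functions"
      using sgn_L2 by (auto simp: cube_functions_def N_def)
    then have "L2_inner (M \<Otimes>\<^sub>M N) F (\<lambda>(x, r). sgn (g r)) = 0"
      using F unfolding L2_orth_cube_def S by blast
    then have "0 = (LINT z|(M \<Otimes>\<^sub>M N). (case z of (x, r) \<Rightarrow> F (x, r) * cnj (sgn (g r))))"
      by (simp add: L2_inner_def case_prod_unfold)
    also have "\<dots> = (LINT r|N. LINT x|M. F (x, r) * cnj (sgn (g r)))"
      using P.integral_snd[OF int] by simp
    also have "\<dots> = (LINT r|N. g r * cnj (sgn (g r)))"
      by (simp add: g_def)
    also have "\<dots> = (LINT r|N. complex_of_real (norm (g r)))"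
    proof (rule Bochner_Integration.integral_cong[OF refl])
      show "g r * cnj (sgn (g r)) = complex_of_real (norm (g r))" for r
        by (cases "g r = 0")
          (simp_all add: sgn_div_norm complex_norm_square[symmetric] power2_eq_square field_simps scaleR_conv_of_real)
    qed
    also have "\<dots> = of_real (LINT r|N. norm (g r))"
      by simp
    finally have "(LINT r|N. norm (g r)) = 0" by simp
    then show ?thesis
      using integral_nonneg_eq_0_iff_AE[of N "\<lambda>r. norm (g r)"] g_int by simp
  qed
  have sq: "AE r in N. integrable M (\<lambda>x. (norm (F (x, r)))\<^sup>2)"
    using P.AE_integrable_snd[of "\<lambda>x r. (norm (F (x, r)))\<^sup>2"] F_sq
    by (simp add: case_prod_unfold)
  \<comment> \<open>The lattice is countable, so the exceptional null sets for its elements can be united.\<close>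
  have slices: "AE r in N. \<forall>n\<in>lattice_of L. AE x in M. F (T n x, r) = plane_wave l (vec_of_int n) * F (x, r)"
  proof (subst AE_ball_countable, rule countableI_type, intro ballI)
    fix n assume "n \<in> lattice_of L"
    then have "AE z in M \<Otimes>\<^sub>M N. F (suspension T (vec_of_int n) z) = plane_wave l (vec_of_int n) * F z"
      using eigen unfolding eigen_equation_def lattice_of_def S plane_wave_def by blast
    from P.AE_pair_snd[OF this] AE_space
    show "AE r in N. AE x in M. F (T n x, r) = plane_wave l (vec_of_int n) * F (x, r)"
    proof eventually_elim
      case (elim r)
      have "vfloor (vec_of_int n + r) = n" "vfrac (vec_of_int n + r) = r"
        using elim(2) by (auto simp: N_def unit_cube_def vfloor_def vfrac_def vec_eq_iff frac_def floor_eq_iff)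
      then show ?case using elim(1) by (simp add: suspension_def)
    qed
  qed
  have "\<not> (AE r in N. AE x in M. F (x, r) = 0)"
  proof
    assume "AE r in N. AE x in M. F (x, r) = 0"
    moreover have "{z \<in> space (M \<Otimes>\<^sub>M N). F (fst z, snd z) = 0} \<in> sets (M \<Otimes>\<^sub>M N)"
      by measurable
    ultimately have "AE z in M \<Otimes>\<^sub>M N. F (fst z, snd z) = 0"
      using P.AE_commute[of "\<lambda>x r. F (x, r) = 0"] P.AE_pair_iff[of "\<lambda>x r. F (x, r) = 0"] by simp
    then show False using nonzero by (simp add: L2_nonzero_def S)
  qed
  moreover have "AE r in N. AE x in M. F (x, r) = 0"
    if no: "\<And>r. r \<in> space N \<Longrightarrow> integrable M (\<lambda>x. (norm (F (x, r)))\<^sup>2) \<Longrightarrow> g r = 0 \<Longrightarrow>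
      \<forall>n\<in>lattice_of L. AE x in M. F (T n x, r) = plane_wave l (vec_of_int n) * F (x, r) \<Longrightarrow>
      AE x in M. F (x, r) = 0"
    using AE_space sq mean_zero slices by eventually_elim (rule no)
  ultimately obtain r where r: "r \<in> space N" "integrable M (\<lambda>x. (norm (F (x, r)))\<^sup>2)" "g r = 0"
      "\<forall>n\<in>lattice_of L. AE x in M. F (T n x, r) = plane_wave l (vec_of_int n) * F (x, r)"
      "\<not> (AE x in M. F (x, r) = 0)"
    by blast
  show thesis
  proof (rule that)
    have "(\<lambda>x. F (x, r)) \<in> L2 M"
      using measurable_Pair1[OF F_meas r(1)] r(2) by (simp add: L2_def)
    then show "mean_zero_eigenfunction M (lattice_of L) T (\<lambda>n. plane_wave l (vec_of_int n)) (\<lambda>x. F (x, r))"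
      using r by (simp add: mean_zero_eigenfunction_def g_def L2_nonzero_def)
  qed
qed

section \<open>From the base to the suspension\<close>

text \<open>Let \<open>U\<close> be the tube of radius \<open>\<epsilon> / 2\<close> around \<open>L\<close>. If \<open>r + m\<close> lies in \<open>U\<close> for some integer
  vector \<open>m\<close>, the point \<open>(x, r)\<close> of the suspension is identified with \<open>(T\<^sup>-\<^sup>m x, r + m)\<close>, where the
  value of the eigenfunction is \<open>e\<^sub>l(r + m) f(T\<^sup>-\<^sup>m x)\<close>. By the gap condition any two choices of \<open>m\<close>
  differ by an element of the lattice, so up to null sets the value does not depend on the choice.\<close>

lemma induced_eigenfunction:
  fixes T :: "int^'d \<Rightarrow> 'a \<Rightarrow> 'a" and L :: "(real^'d) set"
  assumes M: "prob_space M" and T: "free_mp_action M UNIV T" and L: "subspace L"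
    and gap: "\<epsilon> > 0" "\<And>m v. v \<in> L \<Longrightarrow> norm (vec_of_int m - v) < \<epsilon> \<Longrightarrow> m \<in> lattice_of L"
    and eigen_f: "mean_zero_eigenfunction M (lattice_of L) T (\<lambda>n. plane_wave l (vec_of_int n)) f"
  obtains F where "F \<in> L2_orth_cube M" "L2_nonzero (suspension_space M) F" "eigen_equation M T L l F"
proof -
  define N where "N = lebesgue_on (unit_cube :: (real^'d) set)"
  have S: "suspension_space M = M \<Otimes>\<^sub>M N"
    by (simp add: suspension_space_def N_def)
  interpret M: prob_space M by (fact M)
  interpret N: finite_measure N
    unfolding N_def by (rule finite_measure_unit_cube)
  interpret P: pair_sigma_finite M N
    unfolding N_def by (rule pair_sigma_finite_suspension[OF M])
  have f: "f \<in> L2 M" "(LINT x|M. f x) = 0" "L2_nonzero M f"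
    and eigen: "\<And>n. n \<in> lattice_of L \<Longrightarrow> AE x in M. f (T n x) = plane_wave l (vec_of_int n) * f x"
    using eigen_f by (auto simp: mean_zero_eigenfunction_def)
  define U :: "(real^'d) set" where "U = {v. \<exists>w\<in>L. norm (v - w) < \<epsilon> / 2}"
  define D :: "(real^'d) set" where "D = {r. \<exists>m. r + vec_of_int m \<in> U}"
  (* The first admissible translation in an enumeration of the integer vectors: a measurable choice. *)
  define idx :: "real^'d \<Rightarrow> int^'d" where "idx r = from_nat (LEAST k. r + vec_of_int (from_nat k :: int^'d) \<in> U)" for r
  define c where "c r = (if r \<in> D then plane_wave l (r + vec_of_int (idx r)) else 0)" for r
  define F where "F = (\<lambda>(x, r). c r * f (T (- idx r) x))"
  have "U = (\<Union>w\<in>L. ball w (\<epsilon> / 2))"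
    by (auto simp: U_def dist_norm norm_minus_commute)
  then have U_open: "open U" by auto
  have U_add: "w + v \<in> U \<longleftrightarrow> v \<in> U" if w: "w \<in> L" for v w
  proof
    assume "w + v \<in> U"
    then obtain u where "u \<in> L" "norm (w + v - u) < \<epsilon> / 2" by (auto simp: U_def)
    then show "v \<in> U"
      unfolding U_def using w by (intro CollectI bexI[of _ "u - w"] subspace_diff[OF L]) (auto simp: algebra_simps)
  next
    assume "v \<in> U"
    then obtain u where "u \<in> L" "norm (v - u) < \<epsilon> / 2" by (auto simp: U_def)
    then show "w + v \<in> U"
      unfolding U_def using w by (intro CollectI bexI[of _ "u + w"] subspace_add[OF L]) (auto simp: algebra_simps)
  qed
  have U_diff: "m - m' \<in> lattice_of L" if U: "r + vec_of_int m \<in> U" "r + vec_of_int m' \<in> U" for r m m'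
  proof -
    obtain u v where u: "u \<in> L" "norm (r + vec_of_int m - u) < \<epsilon> / 2"
      and v: "v \<in> L" "norm (r + vec_of_int m' - v) < \<epsilon> / 2"
      using U unfolding U_def by blast
    have "vec_of_int (m - m') - (u - v) = (r + vec_of_int m - u) - (r + vec_of_int m' - v)"
      by (simp add: vec_of_int_diff)
    then have "norm (vec_of_int (m - m') - (u - v))
        \<le> norm (r + vec_of_int m - u) + norm (r + vec_of_int m' - v)"
      by (simp only: norm_triangle_ineq4)
    then have "norm (vec_of_int (m - m') - (u - v)) < \<epsilon>"
      using u v by linarith
    then show ?thesis using gap(2) u v subspace_diff[OF L] by blast
  qed
  have idx: "r + vec_of_int (idx r) \<in> U" if r: "r \<in> D" for r
  proof -
    obtain m where "r + vec_of_int m \<in> U" using r by (auto simp: D_def)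
    then have "r + vec_of_int (from_nat (to_nat m) :: int^'d) \<in> U" by simp
    then show ?thesis unfolding idx_def by (rule LeastI)
  qed
  have c_norm: "norm (c r) \<le> 1" for r
    by (simp add: c_def)
  have id_meas [measurable]: "(\<lambda>r. r) \<in> borel_measurable N"
    unfolding N_def by (intro measurable_restrict_space1 measurable_completion) simp
  have vec_meas [measurable]: "(vec_of_int :: int^'d \<Rightarrow> real^'d) \<in> borel_measurable (count_space UNIV)"
    by simp
  have U_pred: "Measurable.pred N (\<lambda>r. r + vec_of_int m \<in> U)" for m
  proof -
    have "(\<lambda>r. r + vec_of_int m) \<in> measurable N borel" by measurable
    moreover have "U \<in> sets borel" using U_open by simp
    ultimately show ?thesis by (rule pred_sets2[rotated])
  qed
  have D_pred [measurable]: "Measurable.pred N (\<lambda>r. r \<in> D)"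
    unfolding D_def mem_Collect_eq using U_pred by (intro pred_intros_countable) auto
  have idx_meas [measurable]: "idx \<in> measurable N (count_space UNIV)"
    unfolding idx_def
    by (rule measurable_compose[OF measurable_Least]) (use U_pred in auto)
  have c_meas [measurable]: "c \<in> borel_measurable N"
    unfolding c_def plane_wave_def by measurable
  have f_meas [measurable]: "f \<in> borel_measurable M"
    using f by (simp add: L2_def)
  have fT_meas [measurable]: "(\<lambda>x. f (T m x)) \<in> borel_measurable M" for m
    using measurable_compose[OF action_measurable[OF T] f_meas] .
  have "(\<lambda>z. f (T (- idx (snd z)) (fst z))) \<in> borel_measurable (M \<Otimes>\<^sub>M N)"
    by (rule measurable_compose_countable[of "\<lambda>m z. f (T (- m) (fst z))" _ _ "\<lambda>z. idx (snd z)"]) measurable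
  then have F_meas [measurable]: "F \<in> borel_measurable (M \<Otimes>\<^sub>M N)"
    unfolding F_def case_prod_unfold by measurable
  have F_sq: "integrable (M \<Otimes>\<^sub>M N) (\<lambda>z. (norm (F z))\<^sup>2)"
  proof (rule integrableI_bounded)
    define K where "K = (\<integral>\<^sup>+x. ennreal ((norm (f x))\<^sup>2) \<partial>M)"
    have "integrable M (\<lambda>x. (norm (f x))\<^sup>2)" using f by (simp add: L2_def)
    then have K: "K < \<infinity>" by (simp add: K_def integrable_iff_bounded)
    have "(\<integral>\<^sup>+z. ennreal (norm ((norm (F z))\<^sup>2)) \<partial>(M \<Otimes>\<^sub>M N))
        = (\<integral>\<^sup>+r. \<integral>\<^sup>+x. ennreal ((norm (F (x, r)))\<^sup>2) \<partial>M \<partial>N)"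
      by (subst P.nn_integral_snd[symmetric]) simp_all
    also have "\<dots> \<le> (\<integral>\<^sup>+r. \<integral>\<^sup>+x. ennreal ((norm (f (T (- idx r) x)))\<^sup>2) \<partial>M \<partial>N)"
    proof (intro nn_integral_mono ennreal_leI power_mono)
      show "norm (F (x, r)) \<le> norm (f (T (- idx r) x))" for x r
        using c_norm[of r] by (simp add: F_def norm_mult mult_left_le_one_le)
    qed simp
    also have "\<dots> = (\<integral>\<^sup>+r. K \<partial>N)"
      unfolding K_def by (intro nn_integral_cong nn_integral_action[OF T]) measurable
    also have "\<dots> = K * emeasure N (space N)" by simp
    also have "\<dots> < \<infinity>"
      using K N.emeasure_finite[of "space N"] by (simp add: ennreal_mult_eq_top_iff less_top[symmetric])
    finally show "(\<integral>\<^sup>+z. ennreal (norm ((norm (F z))\<^sup>2)) \<partial>(M \<Otimes>\<^sub>M N)) < \<infinity>" .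
  qed measurable
  have orth: "F \<in> L2_orth_cube M"
    unfolding L2_orth_cube_def
  proof (intro CollectI conjI ballI)
    show "F \<in> L2 (suspension_space M)" using F_sq by (simp add: L2_def S)
    fix H :: "'a \<times> (real^'d) \<Rightarrow> complex" assume "H \<in> cube_functions"
    then obtain h where H: "H = (\<lambda>(x, s). h s)" by (auto simp: cube_functions_def)
    show "L2_inner (suspension_space M) F H = 0"
    proof (cases "integrable (M \<Otimes>\<^sub>M N) (\<lambda>z. F z * cnj (H z))")
      case True
      then have int: "integrable (M \<Otimes>\<^sub>M N) (\<lambda>(x, r). F (x, r) * cnj (h r))"
        by (simp add: H case_prod_unfold)
      have "L2_inner (suspension_space M) F H = (LINT z|(M \<Otimes>\<^sub>M N). (case z of (x, r) \<Rightarrow> F (x, r) * cnj (h r)))"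
        by (simp add: L2_inner_def S H case_prod_unfold)
      also have "\<dots> = (LINT r|N. LINT x|M. F (x, r) * cnj (h r))"
        using P.integral_snd[OF int] by simp
      also have "\<dots> = (LINT r|N. c r * (LINT x|M. f (T (- idx r) x)) * cnj (h r))"
        by (simp add: F_def)
      also have "\<dots> = 0"
        by (simp add: integral_action[OF T f_meas] f(2))
      finally show ?thesis .
    next
      case False
      then show ?thesis by (simp add: L2_inner_def S not_integrable_integral_eq)
    qed
  qed
  have nonzero: "L2_nonzero (suspension_space M) F"
    unfolding L2_nonzero_def
  proof
    assume "AE z in suspension_space M. F z = 0"
    then have "AE r in N. AE x in M. F (x, r) = 0"
      unfolding S by (rule P.AE_pair_snd)
    then have "AE r in N. r \<notin> U"
    proof eventually_elim
      case (elim r)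
      show "r \<notin> U"
      proof
        assume "r \<in> U"
        then have "r \<in> D" by (auto simp: D_def intro: exI[of _ 0])
        then have "AE x in M. f (T (- idx r) x) = 0"
          using elim by (simp add: F_def c_def)
        from AE_action[OF T this, of "idx r"] AE_space have "AE x in M. f x = 0"
          by eventually_elim (simp add: action_add[OF T, symmetric] action_zero[OF T])
        then show False using f(3) by (simp add: L2_nonzero_def)
      qed
    qed
    then have AE_U: "AE r in lebesgue. r \<in> unit_cube \<longrightarrow> r \<notin> U"
      unfolding N_def using unit_cube_lmeasurable by (subst (asm) AE_restrict_space_iff) (auto simp: fmeasurable_def)
    \<comment> \<open>The tube contains a neighbourhood of the corner 0 of the cube, so its intersection with the open cube is open and nonempty, hence of positive measure.\<close>
    define W where "W = U \<inter> {r. \<forall>i. 0 < r $ i \<and> r $ i < 1}"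
    have "{r. \<forall>i. 0 < r $ i \<and> r $ i < 1} = box 0 (1 :: real^'d)"
      by (auto simp: mem_box_cart)
    then have "open W" unfolding W_def using U_open by (simp add: open_Int open_box)
    moreover have "W \<noteq> {}"
    proof -
      define u :: "real^'d" where "u = 1"
      define s where "s = min (1 / 2) (\<epsilon> / (4 * (norm u + 1)))"
      have s: "0 < s" "s < 1" "s \<le> \<epsilon> / (4 * (norm u + 1))"
        using gap(1) by (auto simp: s_def add_nonneg_pos)
      have "s * (4 * (norm u + 1)) \<le> \<epsilon>"
        using s(3) by (simp add: pos_le_divide_eq add_nonneg_pos)
      then have "4 * s + 4 * (s * norm u) \<le> \<epsilon>"
        by (simp add: algebra_simps)
      moreover have "0 \<le> s * norm u" using s by simp
      ultimately have "s * norm u < \<epsilon> / 2" using s(1) by linarith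
      then have "s *\<^sub>R u \<in> U"
        unfolding U_def using s(1) subspace_0[OF L] by (intro CollectI bexI[of _ 0]) auto
      then have "s *\<^sub>R u \<in> W" using s by (simp add: W_def u_def)
      then show ?thesis by blast
    qed
    ultimately have "\<not> negligible W" by (rule open_not_negligible)
    moreover have "AE r in lebesgue. r \<notin> W"
      using AE_U by eventually_elim (auto simp: W_def unit_cube_def less_imp_le)
    then have "negligible W"
      using \<open>open W\<close> by (simp add: negligible_iff_null_sets AE_iff_null_sets)
    ultimately show False by blast
  qed
  have "eigen_equation M T L l F"
    unfolding eigen_equation_def S
  proof
    fix t assume t: "t \<in> L"
    \<comment> \<open>The translation chosen at \<open>r\<close> is not constant, so one null set must serve for all \<open>m\<close>.\<close>
    have "AE x in M. \<forall>n\<in>lattice_of L. \<forall>m. f (T n (T m x)) = plane_wave l (vec_of_int n) * f (T m x)"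
      by (subst AE_ball_countable, rule countableI_type, intro ballI, subst AE_all_countable, intro allI)
         (rule AE_action[OF T eigen])
    from P.AE_pair_fstI[OF this] AE_space
    show "AE z in M \<Otimes>\<^sub>M N. F (suspension T t z) = exp (2 * of_real pi * \<i> * of_real (l \<bullet> t)) * F z"
    proof eventually_elim
      case (elim z)
      obtain x r where z: "z = (x, r)" by (cases z)
      have x: "x \<in> space M" using elim(2) by (simp add: z space_pair_measure)
      define n where "n = vfloor (t + r)"
      define r' where "r' = vfrac (t + r)"
      have r': "r' = t + r - vec_of_int n"
        by (simp add: r'_def n_def vfrac_def vfloor_def vec_eq_iff frac_def)
      have shift: "r' + vec_of_int m \<in> U \<longleftrightarrow> r + vec_of_int (m - n) \<in> U" for m
        using U_add[OF t, of "r + vec_of_int (m - n)"] by (simp add: r' vec_of_int_diff algebra_simps)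
      have D_iff: "r' \<in> D \<longleftrightarrow> r \<in> D"
      proof
        assume "r' \<in> D"
        then show "r \<in> D" using shift by (auto simp: D_def)
      next
        assume "r \<in> D"
        then obtain m where "r + vec_of_int m \<in> U" by (auto simp: D_def)
        then have "r' + vec_of_int (m + n) \<in> U" using shift[of "m + n"] by simp
        then show "r' \<in> D" by (auto simp: D_def)
      qed
      have "F (T n x, r') = plane_wave l t * F (x, r)"
      proof (cases "r \<in> D")
        case True
        \<comment> \<open>Both \<open>idx r\<close> and \<open>idx r' - n\<close> move \<open>r\<close> into the tube.\<close>
        define k where "k = idx r - (idx r' - n)"
        have "r + vec_of_int (idx r' - n) \<in> U" using idx[of r'] True D_iff shift by simp
        then have k: "k \<in> lattice_of L"
          unfolding k_def by (rule U_diff[OF idx[OF True]])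
        have "T (- idx r') (T n x) = T (- idx r' + n) x"
          by (rule action_add[OF T x, symmetric])
        also have "- idx r' + n = k + - idx r" by (simp add: k_def)
        also have "T (k + - idx r) x = T k (T (- idx r) x)"
          by (rule action_add[OF T x])
        finally have "f (T (- idx r') (T n x)) = plane_wave l (vec_of_int k) * f (T (- idx r) x)"
          using elim(1) k by (simp add: z)
        moreover have "r' + vec_of_int (idx r') + vec_of_int k = t + (r + vec_of_int (idx r))"
          by (simp add: r' k_def vec_of_int_diff)
        then have "plane_wave l (r' + vec_of_int (idx r')) * plane_wave l (vec_of_int k)
            = plane_wave l t * plane_wave l (r + vec_of_int (idx r))"
          by (simp only: plane_wave_add[symmetric])
        ultimately show ?thesis
          using True D_iff by (simp add: F_def c_def mult.assoc[symmetric])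
      next
        case False
        then show ?thesis using D_iff by (simp add: F_def c_def)
      qed
      then show ?case by (simp add: z suspension_def n_def r'_def plane_wave_def)
    qed
  qed
  then show thesis using that orth nonzero by blast
qed

section \<open>Ergodicity and weak mixing in a direction\<close>

lemma direction_eigenfunction_iff:
  fixes T :: "int^'d \<Rightarrow> 'a \<Rightarrow> 'a" and L :: "(real^'d) set"
  assumes M: "prob_space M" and T: "free_mp_action M UNIV T"
    and L: "subspace L" and rational: "completely_rational L"
  shows "(\<exists>F\<in>L2_orth_cube M. L2_nonzero (suspension_space M) F \<and> eigen_equation M T L l F) \<longleftrightarrow>
    (\<exists>f. mean_zero_eigenfunction M (lattice_of L) T (\<lambda>n. plane_wave l (vec_of_int n)) f)"
proof
  assume "\<exists>F\<in>L2_orth_cube M. L2_nonzero (suspension_space M) F \<and> eigen_equation M T L l F"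
  then show "\<exists>f. mean_zero_eigenfunction M (lattice_of L) T (\<lambda>n. plane_wave l (vec_of_int n)) f"
    using slice_eigenfunction[OF M] by blast
next
  obtain \<epsilon> where gap: "\<epsilon> > 0"
    "\<And>m v. v \<in> L \<Longrightarrow> norm (vec_of_int m - v) < \<epsilon> \<Longrightarrow> m \<in> lattice_of L"
    by (rule completely_rational_gap[OF L rational]) blast
  assume "\<exists>f. mean_zero_eigenfunction M (lattice_of L) T (\<lambda>n. plane_wave l (vec_of_int n)) f"
  then obtain f where "mean_zero_eigenfunction M (lattice_of L) T (\<lambda>n. plane_wave l (vec_of_int n)) f" ..
  from induced_eigenfunction[OF M T L gap(1) _ this]
  show "\<exists>F\<in>L2_orth_cube M. L2_nonzero (suspension_space M) F \<and> eigen_equation M T L l F"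
    using gap(2) by blast
qed

lemma character_on_plane_wave:
  "character_on (lattice_of L) (\<lambda>n. plane_wave l (vec_of_int n))"
  by (simp add: character_on_def vec_of_int_add plane_wave_add)

theorem theorem4p13:
  fixes M :: "'a measure"
    and T :: "int^'d \<Rightarrow> 'a \<Rightarrow> 'a"
    and L :: "(real^'d) set"
    and e :: nat
  assumes "lebesgue_prob_space M"
    and "free_mp_action M UNIV T"
    and "ergodic_action M UNIV T"
    and "0 < e" and "e < CARD('d)"
    and "L \<in> grassmannian e"
    and "completely_rational L"
  shows "(ergodic_action M (lattice_of L) T \<longleftrightarrow> ergodic_in_direction M T L) \<and>
         (weak_mixing_action M (lattice_of L) T \<longleftrightarrow> weak_mixing_in_direction M T L)"
proof
  have M: "prob_space M"
    using assms(1) by (simp add: lebesgue_prob_space_def)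
  have T: "free_mp_action M UNIV T" by (rule assms(2))
  have L: "subspace L"
    using assms(6) by (simp add: grassmannian_def)
  note iff = direction_eigenfunction_iff[OF M T L assms(7)]
  show "ergodic_action M (lattice_of L) T \<longleftrightarrow> ergodic_in_direction M T L"
    using iff[of 0]
    by (simp add: ergodic_action_iff_mean_zero[OF M T] ergodic_in_direction_def direction_invariant_def)
  have "(\<exists>\<kappa> f. character_on (lattice_of L) \<kappa> \<and> mean_zero_eigenfunction M (lattice_of L) T \<kappa> f) \<longleftrightarrow>
      (\<exists>l\<in>L. \<exists>f. mean_zero_eigenfunction M (lattice_of L) T (\<lambda>n. plane_wave l (vec_of_int n)) f)"
    (is "?K \<longleftrightarrow> ?W")
  proof
    assume ?K
    then obtain \<kappa> f where \<kappa>: "character_on (lattice_of L) \<kappa>"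
      and f: "mean_zero_eigenfunction M (lattice_of L) T \<kappa> f" by blast
    obtain l where l: "l \<in> L" "\<And>n. n \<in> lattice_of L \<Longrightarrow> \<kappa> n = plane_wave l (vec_of_int n)"
      by (rule character_on_lattice[OF L assms(7) \<kappa>]) blast
    have "mean_zero_eigenfunction M (lattice_of L) T (\<lambda>n. plane_wave l (vec_of_int n)) f"
      using f l(2) by (simp add: mean_zero_eigenfunction_def)
    then show ?W using l(1) by blast
  next
    assume ?W
    then show ?K using character_on_plane_wave by blast
  qed
  also have "\<dots> \<longleftrightarrow> (\<exists>F\<in>L2_orth_cube M. direction_eigenfunction M T L F)"
    unfolding iff[symmetric] direction_eigenfunction_def by blast
  finally show "weak_mixing_action M (lattice_of L) T \<longleftrightarrow> weak_mixing_in_direction M T L"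
    by (simp add: weak_mixing_action_iff_mean_zero[OF M T] weak_mixing_in_direction_def)
qed

end
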